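(* Let $n\ge2$, let $G\subset GL(\mathbb C)$ be the cyclic group generated by $z\mapsto e^{2\pi i/n}z$, so that $Z=\mathbb C$ and $\pi(z)=z^n$. Let $f:(\mathbb C^p,0)\to\mathbb C$ be a germ of a holomorphic function. Then $f$ has a local lift at $0$ (a holomorphic germ $F$ with $F^n=f$) if and only if either $f=0$, or there is a system of indices $(a_1,\dots,a_r)$, $a_k\in\{1,\dots,p\}$, such that, with $A=(a_1,\dots,a_r)$, the functions $f^1_A$ and $f^n_A$ (defined on $\{f\ne0\}$) have holomorphic extensions to a neighborhood of $0$ and $f^n_A(0)\ne0$.
   Context: For a holomorphic germ $f$ on a neighborhood of $0\in\mathbb C^p$ and a multi-index $A=(a_1,\dots,a_r)$ with $\partial_A=\partial^r/\partial x_{a_1}\cdots\partial x_{a_r}$, define on the open set $\{x:f(x)\ne0\}$ the functions $f^1_A:=F^{\,n-1}\partial_AF$ and $f^n_A:=(\partial_AF)^n$, where $F$ is any local holomorphic branch of $f^{1/n}$ (these do not depend on the choice of branch). (In the paper's notation these are $f^1_{a_1\dots a_r}\circ j^rf$ and $f^n_{a_1\dots a_r,\dots,a_1\dots a_r}\circ j^rf$.) *)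

theory Defs
  imports "HOL-Analysis.Analysis"
begin

definition holo_on :: "(complex^'p \<Rightarrow> complex) \<Rightarrow> (complex^'p) set \<Rightarrow> bool" where
  "holo_on f S \<longleftrightarrow> (\<forall>x\<in>S. \<exists>L. (f has_derivative L) (at x) \<and>
      (\<forall>c v. L (c *s v) = c * L v))"

definition cpartial :: "'p \<Rightarrow> (complex^'p \<Rightarrow> complex) \<Rightarrow> complex^'p \<Rightarrow> complex" where
  "cpartial a g x = deriv (\<lambda>t. g (x + t *s axis a 1)) 0"

fun cpartials :: "'p list \<Rightarrow> (complex^'p \<Rightarrow> complex) \<Rightarrow> complex^'p \<Rightarrow> complex" where
  "cpartials [] g = g"
| "cpartials (a # A) g = cpartial a (cpartials A g)"

end

theory Submission
  imports Defs "HOL-Complex_Analysis.Complex_Analysis"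
begin

unbundle no fps_syntax

text \<open>
  If \<open>F\<close> is a lift and \<open>f\<close> is not the zero germ, then some iterated partial derivative
  \<open>\<partial>\<^sub>A F\<close> is nonzero at \<open>0\<close>; any other branch near a point with \<open>f \<noteq> 0\<close> is \<open>F\<close> times an \<open>n\<close>-th
  root of unity, so \<open>F\<^sup>n\<^sup>-\<^sup>1 \<partial>\<^sub>A F\<close> and \<open>(\<partial>\<^sub>A F)\<^sup>n\<close> are the required extensions.
  Conversely, let \<open>h\<close> be a holomorphic \<open>n\<close>-th root of the extension of \<open>f\<^sup>n\<^sub>A\<close> near \<open>0\<close> and \<open>g\<close> the
  extension of \<open>f\<^sup>1\<^sub>A\<close>. Then \<open>q = f h / g\<close> is holomorphic on \<open>{f \<noteq> 0}\<close> with \<open>q\<^sup>n = f\<close>; extended by \<open>0\<close>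
  it is continuous, and holomorphic on every axis-parallel line by the one-dimensional removable
  singularity theorem, hence holomorphic by Osgood's lemma. Osgood's lemma itself follows
  from Cauchy's inequality, which makes the partial derivatives continuous.
\<close>

section \<open>Osgood's lemma\<close>

text \<open>Holomorphy in each variable separately. The slice is tested only at parameter 0; letting
  the base point run through \<open>S\<close> gives differentiability at every parameter of an
  axis-parallel line inside \<open>S\<close>.\<close>

definition sep_holo_on :: "(complex^'p \<Rightarrow> complex) \<Rightarrow> (complex^'p) set \<Rightarrow> bool" where
  "sep_holo_on f S \<longleftrightarrow>
     (\<forall>x\<in>S. \<forall>a. (\<lambda>t. f (x + t *s axis a 1)) field_differentiable (at 0))"

section \<open>Derivatives along complex lines\<close>

lemma norm_smult_axis: "norm (t *s axis a 1 :: complex^'p) = norm t"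
proof -
  have "t *s axis a 1 = (axis a t :: complex^'p)"
    by (simp add: vec_eq_iff axis_def)
  then show ?thesis
    by (simp add: norm_vec_def L2_set_def axis_def if_distrib[of norm] if_distrib[of "\<lambda>x. x^2"] 
        cong: if_cong)
qed

lemma bounded_linear_smult_left: "bounded_linear (\<lambda>t. t *s (v :: complex^'p))"
proof -
  have "linear (\<lambda>t. t *s (v :: complex^'p))"
    by (rule linearI) (simp_all add: vec_eq_iff algebra_simps)
  then show ?thesis by (simp add: linear_conv_bounded_linear)
qed

lemma continuous_on_line: "continuous_on T (\<lambda>t. x + t *s (v :: complex^'p))"
  by (intro continuous_intros linear_continuous_on bounded_linear_smult_left)

lemma has_derivative_along_line:
  fixes f :: "complex^'p \<Rightarrow> complex"
  assumes "(f has_derivative L) (at (x + t *s v))" and "\<And>c v. L (c *s v) = c * L v"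
  shows "((\<lambda>t. f (x + t *s v)) has_field_derivative L v) (at t)"
proof -
  have "((\<lambda>t. x + t *s v) has_derivative (\<lambda>t. t *s v)) (at t)"
    using has_derivative_add[OF has_derivative_const bounded_linear_imp_has_derivative[OF bounded_linear_smult_left]]
    by simp
  from has_derivative_compose[OF this assms(1)] show ?thesis
    unfolding has_field_derivative_def assms(2) by (simp add: mult.commute[of _ "L v"])
qed

lemma cpartial_eq_derivative:
  assumes "(f has_derivative L) (at x)" and "\<And>c v. L (c *s v) = c * L v"
  shows "cpartial a f x = L (axis a 1)"
  unfolding cpartial_def
  by (rule DERIV_imp_deriv) (use has_derivative_along_line[of f L x 0] assms in auto)

lemma derivative_eq_sum_cpartial:
  assumes "(f has_derivative L) (at x)" and "\<And>c v. L (c *s v) = c * L v"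
  shows "L v = (\<Sum>a\<in>UNIV. v $ a * cpartial a f x)"
proof -
  have "L v = L (\<Sum>a\<in>UNIV. v $ a *s axis a 1)" by (simp add: basis_expansion)
  also have "\<dots> = (\<Sum>a\<in>UNIV. L (v $ a *s axis a 1))"
    using has_derivative_linear[OF assms(1)] by (rule linear_sum)
  finally show ?thesis by (simp add: assms(2) cpartial_eq_derivative[OF assms])
qed

lemma holo_on_has_derivative_line:
  fixes f :: "complex^'p \<Rightarrow> complex"
  assumes "holo_on f S" and "x + t *s v \<in> S"
  shows "((\<lambda>t. f (x + t *s v)) has_field_derivative
           (\<Sum>a\<in>UNIV. v $ a * cpartial a f (x + t *s v))) (at t)"
proof -
  from assms obtain L where L: "(f has_derivative L) (at (x + t *s v))" "\<And>c v. L (c *s v) = c * L v"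
    unfolding holo_on_def by blast
  show ?thesis
    using has_derivative_along_line[OF L] derivative_eq_sum_cpartial[OF L] by simp
qed

lemma holo_on_imp_continuous_on: "holo_on f S \<Longrightarrow> continuous_on S f"
  unfolding holo_on_def
  by (meson continuous_at_imp_continuous_on has_derivative_continuous)

lemma holo_on_imp_sep_holo_on: "holo_on f S \<Longrightarrow> sep_holo_on f S"
  unfolding sep_holo_on_def field_differentiable_def
  using holo_on_has_derivative_line[of f S _ 0] by fastforce

lemma sep_holo_on_has_derivative_line:
  assumes "sep_holo_on f S" and "x + t *s axis a 1 \<in> S"
  shows "((\<lambda>t. f (x + t *s axis a 1)) has_field_derivative
           cpartial a f (x + t *s axis a 1)) (at t)"
proof -
  have "((\<lambda>s. f ((x + t *s axis a 1) + s *s axis a 1)) has_field_derivative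
           cpartial a f (x + t *s axis a 1)) (at 0)"
    using assms unfolding sep_holo_on_def cpartial_def
    by (simp add: DERIV_deriv_iff_field_differentiable)
  then have "((\<lambda>s. f (x + (s + t) *s axis a 1)) has_field_derivative
           cpartial a f (x + t *s axis a 1)) (at 0)"
    by (simp add: vector_sadd_rdistrib ac_simps)
  then show ?thesis
    using DERIV_shift[of "\<lambda>t. f (x + t *s axis a 1)" _ 0 t] by simp
qed

lemma sep_holo_on_holomorphic_line:
  assumes "sep_holo_on f S" and "\<And>t. t \<in> T \<Longrightarrow> x + t *s axis a 1 \<in> S"
  shows "(\<lambda>t. f (x + t *s axis a 1)) holomorphic_on T"
  unfolding holomorphic_on_def field_differentiable_def
  using sep_holo_on_has_derivative_line[OF assms(1)] assms(2)
  by (meson has_field_derivative_at_within)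

lemma dist_add_smult_axis:
  "dist x (y + t *s axis a (1::complex)) \<le> dist x y + norm t"
  using norm_triangle_ineq[of "y - x" "t *s axis a 1"]
  by (simp add: dist_norm norm_minus_commute norm_smult_axis algebra_simps)

section \<open>Continuity of partial derivatives and joint differentiability\<close>

lemma continuous_on_cpartial:
  fixes f :: "complex^'p \<Rightarrow> complex"
  assumes "open S" and cont: "continuous_on S f" and sep: "sep_holo_on f S"
  shows "continuous_on S (cpartial a f)"
proof (rule continuous_at_imp_continuous_on, rule ballI)
  fix x assume "x \<in> S"
  then obtain R where R: "R > 0" "cball x R \<subseteq> S"
    using \<open>open S\<close> open_contains_cball by blast
  \<comment> \<open>Half the radius leaves room for moving the base point by \<open>r\<close> and
    then along an axis by another \<open>r\<close> without leaving \<open>cball x R\<close>.\<close>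
  define r where "r = R / 2"
  have r: "r > 0" "R = r + r" using R by (auto simp: r_def)
  have in_S: "y + t *s axis a 1 \<in> S" if "dist x y \<le> r" "norm t \<le> r" for y t
    using dist_add_smult_axis[of x y t a] that R r by (auto simp: subset_iff)
  have "uniformly_continuous_on (cball x R) f"
    using cont R by (intro compact_uniformly_continuous) (auto intro: continuous_on_subset)
  show "isCont (cpartial a f) x"
    unfolding continuous_at_eps_delta
  proof (intro allI impI)
    fix e :: real assume "e > 0"
    \<comment> \<open>Cauchy's inequality divides by \<open>r\<close>, so this bound on
      \<open>u\<close> gives at most \<open>e / 2\<close> for its derivative.\<close>
    then have "e * r / 2 > 0" using r by simp
    with \<open>uniformly_continuous_on (cball x R) f\<close> obtain d where d: "d > 0"
      "\<And>y z. \<lbrakk>y \<in> cball x R; z \<in> cball x R; dist z y < d\<rbrakk> \<Longrightarrow> dist (f z) (f y) < e * r / 2"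
      unfolding uniformly_continuous_on_def by metis
    show "\<exists>d>0. \<forall>y. dist y x < d \<longrightarrow> dist (cpartial a f y) (cpartial a f x) < e"
    proof (intro exI conjI allI impI)
      show "min d r > 0" using d r by simp
      fix y assume y: "dist y x < min d r"
      \<comment> \<open>The difference of two parallel slices: its derivative at 0 is the difference
        of the two partial derivatives, while uniform continuity of \<open>f\<close> makes
        \<open>u\<close> itself small on the whole disc.\<close>
      define u where "u = (\<lambda>t. f (y + t *s axis a 1) - f (x + t *s axis a 1))"
      have in_S': "y + t *s axis a 1 \<in> S" "x + t *s axis a 1 \<in> S" if "norm t \<le> r" for t
        using in_S[OF _ that, of y] in_S[OF _ that, of x] y r by (auto simp: dist_commute)
      have u': "(u has_field_derivative cpartial a f (y + t *s axis a 1) - cpartial a f (x + t *s axis a 1)) (at t)"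
        if "norm t \<le> r" for t
        unfolding u_def by (intro DERIV_diff sep_holo_on_has_derivative_line[OF sep] in_S'[OF that])
      have hol: "u holomorphic_on cball 0 r"
        unfolding holomorphic_on_def field_differentiable_def
        using u' by (meson has_field_derivative_at_within mem_cball_0)
      have "norm ((deriv ^^ 1) u 0) \<le> fact 1 * (e * r / 2) / r ^ 1"
      proof (rule Cauchy_inequality)
        fix t :: complex assume "norm (0 - t) = r"
        then have t: "norm t \<le> r" by simp
        have "dist (y + t *s axis a 1) (x + t *s axis a 1) < d"
          using y by (simp add: dist_norm)
        moreover have "y + t *s axis a 1 \<in> cball x R" "x + t *s axis a 1 \<in> cball x R"
          using dist_add_smult_axis[of x y t a] dist_add_smult_axis[of x x t a] t y r
          by (auto simp: dist_commute)
        ultimately show "norm (u t) \<le> e * r / 2"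
          using d(2) unfolding u_def dist_norm by (meson less_imp_le)
      qed (use hol r in \<open>auto intro: holomorphic_on_subset holomorphic_on_imp_continuous_on\<close>)
      moreover have "deriv u 0 = cpartial a f y - cpartial a f x"
        using DERIV_imp_deriv[OF u'[of 0]] r by simp
      ultimately show "dist (cpartial a f y) (cpartial a f x) < e"
        using r \<open>e > 0\<close> by (simp add: dist_norm)
    qed
  qed
qed

text \<open>Subtracting \<open>t * c\<close> leaves a function whose derivative is bounded by
  \<open>B\<close> on a convex disc. The constant \<open>c\<close> is left free because Osgood's
  lemma compares with the partial derivative at a point other than the base point.\<close>

lemma sep_holo_on_mean_value:
  assumes sep: "sep_holo_on f S"
    and line: "\<And>s. norm s \<le> norm t \<Longrightarrow> x + s *s axis a 1 \<in> S \<and> norm (cpartial a f (x + s *s axis a 1) - c) \<le> B"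
  shows "norm (f (x + t *s axis a 1) - f x - t * c) \<le> B * norm t"
proof -
  have "norm ((f (x + t *s axis a 1) - t * c) - (f (x + 0 *s axis a 1) - 0 * c)) \<le> B * norm (t - 0)"
  proof (rule field_differentiable_bound[where S = "cball 0 (norm t)"])
    fix s :: complex assume "s \<in> cball 0 (norm t)"
    then have s: "norm s \<le> norm t" by simp
    show "((\<lambda>t. f (x + t *s axis a 1) - t * c) has_field_derivative cpartial a f (x + s *s axis a 1) - c)
           (at s within cball 0 (norm t))"
      by (rule has_field_derivative_at_within)
        (auto intro!: derivative_eq_intros sep_holo_on_has_derivative_line[OF sep] simp: line s)
    show "norm (cpartial a f (x + s *s axis a 1) - c) \<le> B" using line s by blast
  qed auto
  then show ?thesis by (simp add: algebra_simps)
qed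

text \<open>Once the partial derivatives are continuous, the classical argument for total
  differentiability applies; the candidate derivative is complex homogeneous by its formula.\<close>

theorem osgood:
  fixes f :: "complex^'p \<Rightarrow> complex"
  assumes "open S" and cont: "continuous_on S f" and sep: "sep_holo_on f S"
  shows "holo_on f S"
  unfolding holo_on_def
proof
  fix x assume "x \<in> S"
  define proj where "proj J v = (\<chi> i. if i \<in> J then v $ i else 0)" for J :: "'p set" and v :: "complex^'p"
  have norm_proj: "norm (proj J v) \<le> norm v" for J v
    by (rule norm_le_componentwise_cart) (auto simp: proj_def)
  have proj_insert: "proj (insert a J) v = proj J v + v $ a *s axis a 1" if "a \<notin> J" for a J v
    using that by (auto simp: proj_def vec_eq_iff axis_def)
  \<comment> \<open>Changing the coordinates one at a time reduces the increment to increments along axes.\<close>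
  have increment: "\<exists>d>0. \<forall>v. norm v < d \<longrightarrow>
      norm (f (x + proj J v) - f x - (\<Sum>a\<in>J. v $ a * cpartial a f x)) \<le> e * norm v"
    if "finite J" "e > 0" for J e
    using that
  proof (induction J arbitrary: e rule: finite_induct)
    case empty
    then show ?case by (auto simp: proj_def zero_vec_def[symmetric] intro!: exI[of _ 1])
  next
    case (insert a J)
    obtain d1 where d1: "d1 > 0" "\<And>v. norm v < d1 \<Longrightarrow>
      norm (f (x + proj J v) - f x - (\<Sum>a\<in>J. v $ a * cpartial a f x)) \<le> e / 2 * norm v"
      using insert.IH[of "e / 2"] insert.prems by auto
    have "isCont (cpartial a f) x"
      using continuous_on_cpartial[OF assms] \<open>x \<in> S\<close> \<open>open S\<close> continuous_on_eq_continuous_at by blast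
    then obtain d2 where d2: "d2 > 0" "\<And>y. dist y x < d2 \<Longrightarrow> dist (cpartial a f y) (cpartial a f x) < e / 2"
      unfolding continuous_at_eps_delta using insert.prems by (meson half_gt_zero)
    obtain d3 where d3: "d3 > 0" "ball x d3 \<subseteq> S"
      using \<open>open S\<close> \<open>x \<in> S\<close> open_contains_ball by blast
    show ?case
    proof (intro exI conjI allI impI)
      \<comment> \<open>The points on the slice used below lie within \<open>norm v + norm v\<close>
        of \<open>x\<close>, one summand for the projection and one for the step along the axis;
        hence the halves.\<close>
      show "min d1 (min (d2 / 2) (d3 / 2)) > 0" using d1 d2 d3 by simp
      fix v :: "complex^'p" assume v: "norm v < min d1 (min (d2 / 2) (d3 / 2))"
      let ?y = "x + proj J v"
      have "norm (f (?y + v $ a *s axis a 1) - f ?y - v $ a * cpartial a f x) \<le> e / 2 * norm (v $ a)"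
      proof (rule sep_holo_on_mean_value[OF sep])
        fix s :: complex assume s: "norm s \<le> norm (v $ a)"
        have "dist x (?y + s *s axis a 1) \<le> dist x ?y + norm s" by (rule dist_add_smult_axis)
        also have "\<dots> \<le> norm v + norm v"
          using norm_proj[of J v] s Finite_Cartesian_Product.norm_nth_le[of v a] by (auto simp: dist_norm)
        finally have "dist (?y + s *s axis a 1) x < d2" "?y + s *s axis a 1 \<in> ball x d3"
          using v by (auto simp: dist_commute)
        then show "?y + s *s axis a 1 \<in> S \<and> norm (cpartial a f (?y + s *s axis a 1) - cpartial a f x) \<le> e / 2"
          using d2 d3 by (auto simp: dist_norm intro: less_imp_le)
      qed
      also have "\<dots> \<le> e / 2 * norm v"
        using insert.prems Finite_Cartesian_Product.norm_nth_le[of v a] by (intro mult_left_mono) auto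
      finally have *: "norm (f (?y + v $ a *s axis a 1) - f ?y - v $ a * cpartial a f x) \<le> e / 2 * norm v" .
      have **: "norm (f ?y - f x - (\<Sum>a\<in>J. v $ a * cpartial a f x)) \<le> e / 2 * norm v"
        using d1 v by auto
      \<comment> \<open>Telescoping: the step in coordinate \<open>a\<close> plus the increment over
        \<open>J\<close>, each with error at most \<open>e / 2 * norm v\<close>.\<close>
      have eq: "f (x + proj (insert a J) v) - f x - (\<Sum>a\<in>insert a J. v $ a * cpartial a f x) =
         (f (?y + v $ a *s axis a 1) - f ?y - v $ a * cpartial a f x) +
         (f ?y - f x - (\<Sum>a\<in>J. v $ a * cpartial a f x))"
        using insert.hyps by (simp add: proj_insert add.assoc)
      show "norm (f (x + proj (insert a J) v) - f x - (\<Sum>a\<in>insert a J. v $ a * cpartial a f x)) \<le> e * norm v"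
        unfolding eq using norm_triangle_mono[OF * **] by (simp only: field_sum_of_halves flip: distrib_right)
    qed
  qed
  define L where "L v = (\<Sum>a\<in>UNIV. v $ a * cpartial a f x)" for v :: "complex^'p"
  have hom: "L (c *s v) = c * L v" for c v
    by (simp add: L_def sum_distrib_left mult.assoc)
  have "linear L"
    by (rule linearI) (simp_all add: L_def algebra_simps sum.distrib scaleR_sum_right)
  have "proj UNIV v = v" for v by (simp add: proj_def)
  have "(f has_derivative L) (at x)"
    unfolding has_derivative_at_alt
  proof (intro conjI allI impI)
    show "bounded_linear L" using \<open>linear L\<close> by (simp add: linear_conv_bounded_linear)
    fix e :: real assume "e > 0"
    then obtain d where "d > 0" "\<And>v. norm v < d \<Longrightarrow> norm (f (x + v) - f x - L v) \<le> e * norm v"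
      using increment[of UNIV e] by (auto simp: L_def \<open>\<And>v. proj UNIV v = v\<close>)
    then show "\<exists>d>0. \<forall>y. norm (y - x) < d \<longrightarrow> norm (f y - f x - L (y - x)) \<le> e * norm (y - x)"
      by (metis add_diff_cancel_left' diff_add_cancel add.commute)
  qed
  with hom show "\<exists>L. (f has_derivative L) (at x) \<and> (\<forall>c v. L (c *s v) = c * L v)" by blast
qed

section \<open>Closure properties of holomorphic functions\<close>

lemma holo_on_subset: "holo_on f S \<Longrightarrow> T \<subseteq> S \<Longrightarrow> holo_on f T"
  unfolding holo_on_def by blast

lemma holo_on_cong:
  assumes "holo_on f S" and "open S" and "\<And>x. x \<in> S \<Longrightarrow> f x = g x"
  shows "holo_on g S"
  using assms unfolding holo_on_def by (meson has_derivative_transform_within_open)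

lemma holo_on_const: "holo_on (\<lambda>_. c) S"
  unfolding holo_on_def by (auto intro!: exI[of _ "\<lambda>_. 0"])

lemma holo_on_compose:
  assumes "holo_on g S" and "\<And>x. x \<in> S \<Longrightarrow> \<phi> field_differentiable (at (g x))"
  shows "holo_on (\<lambda>x. \<phi> (g x)) S"
  unfolding holo_on_def
proof
  fix x assume x: "x \<in> S"
  from assms(1) x obtain L where L: "(g has_derivative L) (at x)" "\<And>c v. L (c *s v) = c * L v"
    unfolding holo_on_def by blast
  obtain D where "(\<phi> has_derivative (*) D) (at (g x))"
    using assms(2)[OF x] unfolding field_differentiable_def has_field_derivative_def by blast
  from has_derivative_compose[OF L(1) this]
  show "\<exists>L. ((\<lambda>x. \<phi> (g x)) has_derivative L) (at x) \<and> (\<forall>c v. L (c *s v) = c * L v)"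
    by (intro exI[of _ "\<lambda>v. D * L v"]) (auto simp: L(2))
qed

lemma holo_on_mult:
  assumes "holo_on f S" and "holo_on g S"
  shows "holo_on (\<lambda>x. f x * g x) S"
  unfolding holo_on_def
proof
  fix x assume x: "x \<in> S"
  from assms(1) x obtain L where L: "(f has_derivative L) (at x)" "\<And>c v. L (c *s v) = c * L v"
    unfolding holo_on_def by blast
  from assms(2) x obtain M where M: "(g has_derivative M) (at x)" "\<And>c v. M (c *s v) = c * M v"
    unfolding holo_on_def by blast
  from has_derivative_mult[OF L(1) M(1)]
  show "\<exists>L. ((\<lambda>x. f x * g x) has_derivative L) (at x) \<and> (\<forall>c v. L (c *s v) = c * L v)"
    by (intro exI[of _ "\<lambda>v. f x * M v + L v * g x"]) (auto simp: L(2) M(2) algebra_simps)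
qed

lemma holo_on_power: "holo_on f S \<Longrightarrow> holo_on (\<lambda>x. f x ^ n) S"
  by (erule holo_on_compose) (auto simp: field_differentiable_power)

lemma holo_on_divide:
  assumes "holo_on f S" and "holo_on g S" and "\<And>x. x \<in> S \<Longrightarrow> g x \<noteq> 0"
  shows "holo_on (\<lambda>x. f x / g x) S"
proof -
  have "holo_on (\<lambda>x. inverse (g x)) S"
    by (rule holo_on_compose[OF assms(2)]) (auto simp: assms(3) intro: field_differentiable_inverse)
  from holo_on_mult[OF assms(1) this] show ?thesis by (simp add: divide_inverse)
qed

section \<open>Iterated partial derivatives\<close>

text \<open>Along direction \<open>b\<close>, the partial derivative in direction \<open>a\<close>
  is a uniform limit of difference quotients of \<open>f\<close>. These are holomorphic in the
  parameter of the slice, so by Weierstrass's theorem the limit is too.\<close>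

lemma sep_holo_on_cpartial:
  fixes f :: "complex^'p \<Rightarrow> complex"
  assumes "open S" and "holo_on f S"
  shows "sep_holo_on (cpartial a f) S"
  unfolding sep_holo_on_def
proof (intro ballI allI)
  fix x b assume "x \<in> S"
  have cont: "continuous_on S f" and sep: "sep_holo_on f S"
    using assms holo_on_imp_continuous_on holo_on_imp_sep_holo_on by auto
  obtain R where R: "R > 0" "cball x R \<subseteq> S"
    using \<open>open S\<close> \<open>x \<in> S\<close> open_contains_cball by blast
  define r where "r = R / 2"
  have r: "r > 0" "R = r + r" using R by (auto simp: r_def)
  have in_ball: "x + s *s axis b 1 + t *s axis a 1 \<in> cball x R" if "norm s \<le> r" "norm t \<le> r" for s t
    using dist_add_smult_axis[of x "x + s *s axis b 1" t a] dist_add_smult_axis[of x x s b] that r by simp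
  \<comment> \<open>Nonzero increments tending to 0; the bound by \<open>r\<close> keeps the shifted
    slices inside \<open>cball x R\<close>.\<close>
  define h where "h k = complex_of_real (r / real (Suc k))" for k
  have h: "h k \<noteq> 0" "norm (h k) \<le> r" for k
    using r by (auto simp: h_def norm_divide divide_le_eq_1 field_simps simp del: of_nat_Suc)
  define D where "D k s = (f (x + h k *s axis a 1 + s *s axis b 1) - f (x + s *s axis b 1)) / h k" for k s
  have hol: "D k holomorphic_on cball 0 r" for k
    unfolding D_def
  proof (intro holomorphic_intros sep_holo_on_holomorphic_line[OF sep] h)
    fix s :: complex assume "s \<in> cball 0 r"
    then have "norm s \<le> r" by simp
    then show "x + h k *s axis a 1 + s *s axis b 1 \<in> S" "x + s *s axis b 1 \<in> S"
      using in_ball[of s "h k"] in_ball[of s 0] R h r by (auto simp: subset_iff ac_simps)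
  qed
  have "uniform_limit (cball 0 r) D (\<lambda>s. cpartial a f (x + s *s axis b 1)) sequentially"
    unfolding uniform_limit_iff
  proof (intro allI impI)
    fix e :: real assume "e > 0"
    have "uniformly_continuous_on (cball x R) (cpartial a f)"
      using continuous_on_cpartial[OF \<open>open S\<close> cont sep] R
      by (intro compact_uniformly_continuous) (auto intro: continuous_on_subset)
    then obtain d where d: "d > 0"
      "\<And>y z. \<lbrakk>y \<in> cball x R; z \<in> cball x R; dist z y < d\<rbrakk> \<Longrightarrow> dist (cpartial a f z) (cpartial a f y) < e / 2"
      unfolding uniformly_continuous_on_def using \<open>e > 0\<close> by (metis half_gt_zero)
    have "(\<lambda>k. r / real (Suc k)) \<longlonglongrightarrow> 0"
      using tendsto_mult_right_zero[OF LIMSEQ_inverse_real_of_nat, of r] by (simp add: divide_inverse)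
    then have "\<forall>\<^sub>F k in sequentially. r / real (Suc k) < d"
      using d(1) by (rule order_tendstoD)
    then show "\<forall>\<^sub>F k in sequentially. \<forall>s\<in>cball 0 r. dist (D k s) (cpartial a f (x + s *s axis b 1)) < e"
    proof (rule eventually_mono, intro ballI)
      fix k and s :: complex assume k: "r / real (Suc k) < d" and "s \<in> cball 0 r"
      then have s: "norm s \<le> r" by simp
      let ?y = "x + s *s axis b 1"
      have hd: "norm (h k) < d" using k r by (simp add: h_def norm_divide del: of_nat_Suc)
      \<comment> \<open>Here \<open>c\<close> is the partial derivative at the base point
        \<open>?y\<close>; uniform continuity of the partial on the compact ball makes the estimate
        uniform in \<open>s\<close>.\<close>
      have "norm (f (?y + h k *s axis a 1) - f ?y - h k * cpartial a f ?y) \<le> e / 2 * norm (h k)"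
      proof (rule sep_holo_on_mean_value[OF sep])
        fix t :: complex assume t: "norm t \<le> norm (h k)"
        have "?y \<in> cball x R" "?y + t *s axis a 1 \<in> cball x R"
          using in_ball[OF s, of 0] in_ball[OF s, of t] t h(2)[of k] r by auto
        moreover have "dist (?y + t *s axis a 1) ?y < d"
          using t hd by (simp add: dist_norm norm_smult_axis)
        ultimately show "?y + t *s axis a 1 \<in> S \<and>
            norm (cpartial a f (?y + t *s axis a 1) - cpartial a f ?y) \<le> e / 2"
          using d(2) R by (metis dist_norm less_imp_le subsetD)
      qed
      moreover have "D k s - cpartial a f ?y = (f (?y + h k *s axis a 1) - f ?y - h k * cpartial a f ?y) / h k"
        using h(1)[of k] by (simp add: D_def field_simps)
      ultimately have "norm (D k s - cpartial a f ?y) \<le> e / 2"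
        using h(1)[of k] by (simp add: norm_divide divide_le_eq)
      then show "dist (D k s) (cpartial a f ?y) < e"
        using \<open>e > 0\<close> by (simp add: dist_norm)
    qed
  qed
  moreover have "\<forall>\<^sub>F k in sequentially. continuous_on (cball 0 r) (D k) \<and> D k holomorphic_on ball 0 r"
    using holomorphic_on_imp_continuous_on[OF hol] holomorphic_on_subset[OF hol ball_subset_cball] by simp
  ultimately have "(\<lambda>s. cpartial a f (x + s *s axis b 1)) holomorphic_on ball 0 r"
    using holomorphic_uniform_limit trivial_limit_sequentially by blast
  then show "(\<lambda>s. cpartial a f (x + s *s axis b 1)) field_differentiable at 0"
    using r by (intro holomorphic_on_imp_differentiable_at[of _ "ball 0 r"]) auto
qed

lemma holo_on_cpartial: "open S \<Longrightarrow> holo_on f S \<Longrightarrow> holo_on (cpartial a f) S"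
  using osgood sep_holo_on_cpartial continuous_on_cpartial holo_on_imp_continuous_on
    holo_on_imp_sep_holo_on by metis

lemma holo_on_cpartials: "open S \<Longrightarrow> holo_on f S \<Longrightarrow> holo_on (cpartials A f) S"
  by (induction A) (auto intro: holo_on_cpartial)

lemma cpartials_append: "cpartials (A @ B) f = cpartials A (cpartials B f)"
  by (induction A) auto

lemma open_line_preimage:
  assumes "open S" shows "open {t. x + t *s (v :: complex^'p) \<in> S}"
  using open_vimage[OF assms continuous_on_line] by (simp add: vimage_def)

lemma cpartial_cong:
  assumes "open S" and "x \<in> S" and "\<And>y. y \<in> S \<Longrightarrow> f y = g y"
  shows "cpartial a f x = cpartial a g x"
  unfolding cpartial_def
  using eventually_nhds_in_open[OF open_line_preimage[OF \<open>open S\<close>, of x "axis a 1"], of 0] assms(2,3)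
  by (intro deriv_cong_ev) (auto elim!: eventually_mono)

text \<open>Iterated partials at a point depend only on the germ there. This allows a branch to be
  replaced by a multiple of another one that agrees with it only near the point.\<close>

lemma cpartials_cong:
  assumes "open S" and "x \<in> S" and "\<And>y. y \<in> S \<Longrightarrow> f y = g y"
  shows "cpartials A f x = cpartials A g x"
  using assms(2)
proof (induction A arbitrary: x)
  case (Cons a A)
  show ?case using cpartial_cong[OF \<open>open S\<close> Cons.prems Cons.IH] by simp
qed (simp add: assms(3))

lemma cpartials_cmult:
  assumes "open S" and "x \<in> S" and "holo_on f S"
  shows "cpartials A (\<lambda>y. c * f y) x = c * cpartials A f x"
  using assms(2)
proof (induction A arbitrary: x)
  case (Cons a A)
  have "sep_holo_on (cpartials A f) S"
    using assms holo_on_cpartials holo_on_imp_sep_holo_on by blast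
  then have "deriv (\<lambda>t. c * cpartials A f (x + t *s axis a 1)) 0 =
      c * deriv (\<lambda>t. cpartials A f (x + t *s axis a 1)) 0"
    using Cons.prems unfolding sep_holo_on_def by (intro deriv_cmult) auto
  then show ?case
    using cpartial_cong[OF \<open>open S\<close> Cons.prems, of "cpartials A (\<lambda>y. c * f y)" "\<lambda>y. c * cpartials A f y" a]
      Cons.IH by (simp add: cpartial_def)
qed simp

section \<open>The identity theorem\<close>

lemma higher_deriv_linear_combination:
  assumes "finite J" and "\<And>a. a \<in> J \<Longrightarrow> g a holomorphic_on T" and "open T" and "z \<in> T"
  shows "(deriv ^^ k) (\<lambda>t. \<Sum>a\<in>J. c a * g a t) z = (\<Sum>a\<in>J. c a * (deriv ^^ k) (g a) z)"
  using assms(1,2)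
proof (induction J rule: finite_induct)
  case empty
  have "(deriv ^^ k) (\<lambda>_. 0) = (\<lambda>_. 0 :: complex)" by (induction k) auto
  then show ?case by simp
next
  case (insert a J)
  have "(deriv ^^ k) (\<lambda>t. c a * g a t + (\<Sum>a\<in>J. c a * g a t)) z =
     (deriv ^^ k) (\<lambda>t. c a * g a t) z + (deriv ^^ k) (\<lambda>t. \<Sum>a\<in>J. c a * g a t) z"
    using insert.prems assms(3,4) by (intro higher_deriv_add[of _ T] holomorphic_intros) auto
  also have "(deriv ^^ k) (\<lambda>t. c a * g a t) z = c a * (deriv ^^ k) (g a) z"
    using insert.prems assms(3,4) by (intro higher_deriv_cmult[of _ T]) auto
  finally show ?case using insert by simp
qed

lemma holo_on_holomorphic_line:
  assumes "holo_on f S" and "\<And>t. t \<in> T \<Longrightarrow> x + t *s v \<in> S"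
  shows "(\<lambda>t. f (x + t *s v)) holomorphic_on T"
  unfolding holomorphic_on_def field_differentiable_def
  using holo_on_has_derivative_line[OF assms(1)] assms(2)
  by (meson has_field_derivative_at_within)

text \<open>By the chain rule, one derivative along the line gives a combination, with constant
  coefficients \<open>v $ a\<close>, of slices of first partials. Each first partial again satisfies
  the hypotheses, so the induction must generalise over \<open>f\<close>.\<close>

lemma higher_deriv_line_eq_0:
  assumes "open S" and "x \<in> S" and "holo_on f S" and "\<And>A. cpartials A f x = 0"
  shows "(deriv ^^ k) (\<lambda>t. f (x + t *s v)) 0 = 0"
  using assms(3,4)
proof (induction k arbitrary: f)
  case 0
  from "0.prems"(2)[of "[]"] show ?case by simp
next
  case (Suc k)
  define T where "T = {t. x + t *s v \<in> S}"
  have T: "open T" "0 \<in> T" using open_line_preimage assms by (auto simp: T_def)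
  have "(deriv ^^ Suc k) (\<lambda>t. f (x + t *s v)) 0 = (deriv ^^ k) (deriv (\<lambda>t. f (x + t *s v))) 0"
    by (simp add: funpow_swap1)
  also have "\<dots> = (deriv ^^ k) (\<lambda>t. \<Sum>a\<in>UNIV. v $ a * cpartial a f (x + t *s v)) 0"
    using eventually_nhds_in_open[OF T] holo_on_has_derivative_line[OF Suc.prems(1)]
    by (intro higher_deriv_cong_ev) (auto elim!: eventually_mono simp: T_def intro!: DERIV_imp_deriv)
  also have "\<dots> = (\<Sum>a\<in>UNIV. v $ a * (deriv ^^ k) (\<lambda>t. cpartial a f (x + t *s v)) 0)"
    using T holo_on_cpartial[OF \<open>open S\<close> Suc.prems(1)]
    by (intro higher_deriv_linear_combination[of _ _ T] holo_on_holomorphic_line) (auto simp: T_def)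
  also have "\<dots> = 0"
  proof (intro sum.neutral ballI)
    fix a
    \<comment> \<open>\<open>cpartials\<close> applies the last index of its list first, so the new
      innermost derivative is appended at the end.\<close>
    have "cpartials A (cpartial a f) x = 0" for A
      using Suc.prems(2)[of "A @ [a]"] by (simp add: cpartials_append)
    then show "v $ a * (deriv ^^ k) (\<lambda>t. cpartial a f (x + t *s v)) 0 = 0"
      using Suc.IH[OF holo_on_cpartial[OF \<open>open S\<close> Suc.prems(1)]] by simp
  qed
  finally show ?case .
qed

text \<open>The one-variable identity theorem on the complex line from \<open>x\<close> (parameter
  0) to \<open>y\<close> (parameter 1). In a ball the parameter set \<open>T\<close> is convex,
  hence connected.\<close>

lemma holo_on_ball_eq_0:
  fixes f :: "complex^'p \<Rightarrow> complex"
  assumes "holo_on f (ball x R)" and "\<And>A. cpartials A f x = 0" and "y \<in> ball x R"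
  shows "f y = 0"
proof -
  define T where "T = {t. x + t *s (y - x) \<in> ball x R}"
  have convex: "convex T"
  proof -
    have "linear (\<lambda>t. t *s (y - x))"
      using bounded_linear_smult_left bounded_linear.linear by blast
    moreover have "T = (\<lambda>t. t *s (y - x)) -` ball 0 R"
      by (auto simp: T_def dist_norm)
    ultimately show ?thesis using convex_linear_vimage by (metis convex_ball)
  qed
  have "R > 0" using assms(3) by (metis dist_not_less_zero le_less_trans mem_ball not_less)
  have "f (x + 1 *s (y - x)) = 0"
  proof (rule holomorphic_fun_eq_0_on_connected[where f = "\<lambda>t. f (x + t *s (y - x))" and S = T and z = 0])
    show "(\<lambda>t. f (x + t *s (y - x))) holomorphic_on T"
      by (rule holo_on_holomorphic_line[OF assms(1)]) (simp add: T_def)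
    show "open T" unfolding T_def by (rule open_line_preimage) simp
    show "(deriv ^^ k) (\<lambda>t. f (x + t *s (y - x))) 0 = 0" for k
      using assms \<open>R > 0\<close> by (intro higher_deriv_line_eq_0[of "ball x R"]) auto
  qed (use convex convex_connected assms(3) \<open>R > 0\<close> in \<open>auto simp: T_def\<close>)
  then show ?thesis by simp
qed

section \<open>Roots of holomorphic functions\<close>

text \<open>Dividing by \<open>g x\<close> moves the values near \<open>x\<close> into the unit disc
  about 1, away from the branch cut of \<open>Ln\<close>; adding \<open>Ln (g x)\<close> restores
  the factor. An exponential has no zeros.\<close>

lemma holo_on_nth_root:
  fixes g :: "complex^'p \<Rightarrow> complex"
  assumes "open S" and "x \<in> S" and "holo_on g S" and "g x \<noteq> 0" and "n > 0"
  obtains U h where "open U" "x \<in> U" "U \<subseteq> S" "holo_on h U" "\<And>y. y \<in> U \<Longrightarrow> h y ^ n = g y"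
    "\<And>y. y \<in> U \<Longrightarrow> h y \<noteq> 0"
proof
  define U where "U = {y \<in> S. g y / g x \<in> ball 1 1}"
  define h where "h y = exp ((Ln (g y / g x) + Ln (g x)) / of_nat n)" for y
  have "U = S \<inter> (\<lambda>y. g y / g x) -` ball 1 1" by (auto simp: U_def)
  then show "open U"
    using \<open>open S\<close> holo_on_imp_continuous_on[OF \<open>holo_on g S\<close>] \<open>g x \<noteq> 0\<close>
    by (auto intro!: continuous_open_preimage continuous_intros)
  show "x \<in> U" "U \<subseteq> S" using assms by (auto simp: U_def)
  have slit: "g y / g x \<notin> \<real>\<^sub>\<le>\<^sub>0" if "y \<in> U" for y
  proof
    assume "g y / g x \<in> \<real>\<^sub>\<le>\<^sub>0"
    then have "Re (1 - g y / g x) \<ge> 1" by (auto simp: complex_nonpos_Reals_iff)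
    moreover have "norm (1 - g y / g x) < 1" using that by (simp add: U_def dist_norm)
    ultimately show False using complex_Re_le_cmod[of "1 - g y / g x"] by simp
  qed
  show "holo_on h U"
    unfolding h_def
  proof (rule holo_on_compose[where \<phi> = "\<lambda>w. exp ((Ln (w / g x) + Ln (g x)) / of_nat n)"])
    show "holo_on g U" using \<open>holo_on g S\<close> \<open>U \<subseteq> S\<close> by (rule holo_on_subset)
    fix y assume "y \<in> U"
    from slit[OF this]
    show "(\<lambda>w. exp ((Ln (w / g x) + Ln (g x)) / of_nat n)) field_differentiable at (g y)"
      using \<open>g x \<noteq> 0\<close> unfolding field_differentiable_def
      by (intro exI) (rule derivative_eq_intros refl | assumption | simp add: \<open>n > 0\<close>)+
  qed
  fix y assume "y \<in> U"
  then have "g y / g x \<noteq> 0" using slit by force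
  have "h y ^ n = exp (Ln (g y / g x) + Ln (g x))"
    using \<open>n > 0\<close> by (simp add: h_def flip: exp_of_nat_mult)
  also have "\<dots> = g y" using \<open>g y / g x \<noteq> 0\<close> \<open>g x \<noteq> 0\<close> by (simp add: exp_add)
  finally show "h y ^ n = g y" .
  show "h y \<noteq> 0" by (simp add: h_def)
qed

text \<open>On a ball where \<open>F\<close> has no zero, \<open>G / F\<close> is continuous with
  values in the finite set of \<open>n\<close>-th roots of unity, so connectedness makes it
  constant.\<close>

lemma nth_roots_locally_proportional:
  fixes F G :: "'a::real_normed_vector \<Rightarrow> complex"
  assumes "open W" and "x \<in> W" and "continuous_on W F" and "continuous_on W G"
    and "\<And>y. y \<in> W \<Longrightarrow> G y ^ n = F y ^ n" and "F x \<noteq> 0" and "n > 0"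
  obtains c V where "c ^ n = 1" "open V" "x \<in> V" "V \<subseteq> W" "\<And>y. y \<in> V \<Longrightarrow> G y = c * F y"
proof -
  have "open (W \<inter> F -` (- {0}))"
    using assms by (intro continuous_open_preimage) auto
  then obtain e where e: "e > 0" "ball x e \<subseteq> W \<inter> F -` (- {0})"
    using assms open_contains_ball by (metis Compl_iff IntI singletonD vimageI)
  have "(\<lambda>y. G y / F y) constant_on ball x e"
  proof (rule continuous_finite_range_constant)
    show "continuous_on (ball x e) (\<lambda>y. G y / F y)"
      using e assms by (intro continuous_on_divide) (auto intro: continuous_on_subset)
    have "(G y / F y) ^ n = 1" if "y \<in> ball x e" for y
      using that e assms(5)[of y] by (auto simp: power_divide)
    then have "(\<lambda>y. G y / F y) ` ball x e \<subseteq> {z. z ^ n = 1}" by auto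
    moreover have "finite {z::complex. z ^ n = 1}"
      using \<open>n > 0\<close> by (intro finite_roots_unity) simp
    ultimately show "finite ((\<lambda>y. G y / F y) ` ball x e)" by (rule finite_subset)
  qed simp
  then obtain c where c: "\<And>y. y \<in> ball x e \<Longrightarrow> G y / F y = c" unfolding constant_on_def by blast
  then have "c = G x / F x" using e by force
  then have "c ^ n = 1" using assms(2,5,6) by (simp add: power_divide)
  moreover have "G y = c * F y" if "y \<in> ball x e" for y
    using c[OF that] subsetD[OF e(2) that] by (simp add: field_simps)
  ultimately show ?thesis using that[of c "ball x e"] e by auto
qed

text \<open>The modulus of \<open>q\<close> is the real \<open>n\<close>-th root of the modulus of
  \<open>f\<close>; at a zero, convergence of the modulus to 0 is convergence of
  \<open>q\<close>.\<close>

lemma isCont_nth_root_at_zero: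
  fixes q :: "'a::metric_space \<Rightarrow> complex"
  assumes "isCont f x" and "f x = 0" and "open S" and "x \<in> S" and "\<And>y. y \<in> S \<Longrightarrow> q y ^ n = f y"
    and "n > 0"
  shows "isCont q x"
  unfolding isCont_def
proof -
  have "q x = 0" using assms by (metis power_eq_0_iff)
  have "((\<lambda>y. root n (norm (f y))) \<longlongrightarrow> root n (norm (f x))) (at x)"
    using assms(1) unfolding isCont_def by (intro tendsto_intros)
  moreover have "\<forall>\<^sub>F y in at x. root n (norm (f y)) = norm (q y)"
    using assms(3,4,5,6)
    by (intro eventually_at_topological[THEN iffD2] exI[of _ S])
      (auto simp: norm_power real_root_power_cancel simp flip: assms(5))
  ultimately have "((\<lambda>y. norm (q y)) \<longlongrightarrow> 0) (at x)"
    using \<open>f x = 0\<close> by (simp add: tendsto_cong)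
  then show "(q \<longlongrightarrow> q x) (at x)"
    using \<open>q x = 0\<close> by (simp add: tendsto_norm_zero_iff)
qed

text \<open>A special case of Riemann's extension theorem: on every axis-parallel line the zeros of
  \<open>f\<close> are isolated or \<open>f\<close>, hence \<open>q\<close>, vanishes identically, so \<open>q\<close> is separately holomorphic.\<close>

lemma holo_on_nth_root_off_zeros:
  fixes f q :: "complex^'p \<Rightarrow> complex"
  assumes "open S" and "holo_on f S" and "n > 0" and root: "\<And>x. x \<in> S \<Longrightarrow> q x ^ n = f x"
    and off: "holo_on q {x \<in> S. f x \<noteq> 0}"
  shows "holo_on q S"
proof (rule osgood[OF \<open>open S\<close>])
  have contf: "continuous_on S f" using assms holo_on_imp_continuous_on by blast
  have q0: "q x = 0" if "x \<in> S" "f x = 0" for x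
    using root that \<open>n > 0\<close> by (metis power_eq_0_iff)
  show contq: "continuous_on S q"
  proof (rule continuous_at_imp_continuous_on, rule ballI)
    fix x assume "x \<in> S"
    show "isCont q x"
    proof (cases "f x = 0")
      case True
      have "isCont f x"
        using contf \<open>open S\<close> \<open>x \<in> S\<close> continuous_on_eq_continuous_at by blast
      then show ?thesis
        using True \<open>open S\<close> \<open>x \<in> S\<close> root \<open>n > 0\<close> by (rule isCont_nth_root_at_zero)
    next
      case False
      then obtain L where "(q has_derivative L) (at x)"
        using off \<open>x \<in> S\<close> unfolding holo_on_def by auto
      then show ?thesis by (rule has_derivative_continuous)
    qed
  qed
  show "sep_holo_on q S"
    unfolding sep_holo_on_def
  proof (intro ballI allI)
    fix x a assume "x \<in> S"
    define \<gamma> where "\<gamma> t = x + t *s axis a 1" for t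
    show "(\<lambda>t. q (x + t *s axis a 1)) field_differentiable at 0"
    proof (cases "f x = 0")
      case False
      then show ?thesis
        using holo_on_imp_sep_holo_on[OF off] \<open>x \<in> S\<close> unfolding sep_holo_on_def by simp
    next
      case True
      obtain r where r: "r > 0" "ball 0 r \<subseteq> {t. \<gamma> t \<in> S}"
      proof -
        have "open {t. \<gamma> t \<in> S}" "0 \<in> {t. \<gamma> t \<in> S}"
          using open_line_preimage[OF \<open>open S\<close>] \<open>x \<in> S\<close> by (auto simp: \<gamma>_def)
        then show ?thesis using that openE by blast
      qed
      have hol: "(\<lambda>t. f (\<gamma> t)) holomorphic_on ball 0 r"
        unfolding \<gamma>_def using r by (intro holo_on_holomorphic_line[OF assms(2)]) (auto simp: \<gamma>_def)
      show ?thesis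
      proof (cases "\<exists>b \<in> ball 0 r. f (\<gamma> b) \<noteq> 0")
        case False
        have "(\<lambda>t. q (\<gamma> t)) holomorphic_on ball 0 r"
        proof (rule holomorphic_transform)
          show "(\<lambda>t. 0) holomorphic_on ball 0 r" by simp
          fix t :: complex assume t: "t \<in> ball 0 r"
          then have "\<gamma> t \<in> S" using r(2) by blast
          moreover have "f (\<gamma> t) = 0" using t False by blast
          ultimately show "0 = q (\<gamma> t)" using q0 by simp
        qed
        then show ?thesis
          using r(1) unfolding \<gamma>_def
          by (intro holomorphic_on_imp_differentiable_at[of _ "ball 0 r"]) auto
      next
        case True
        then obtain b where b: "b \<in> ball 0 r" "f (\<gamma> b) \<noteq> 0" by blast
        have zero: "f (\<gamma> 0) = 0" "(0::complex) \<in> ball 0 r" using \<open>f x = 0\<close> r(1) by (simp_all add: \<gamma>_def)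
        obtain s where s: "s > 0" "ball (0::complex) s \<subseteq> ball 0 r" "\<And>t. t \<in> ball 0 s - {0} \<Longrightarrow> f (\<gamma> t) \<noteq> 0"
          by (rule isolated_zeros[OF hol open_ball connected_ball zero(2,1) b]) (rule that)
        \<comment> \<open>The slice is holomorphic off the centre by \<open>off\<close> and
          continuous at the centre by \<open>contq\<close>, so the singularity is removable with the
          value it already has.\<close>
        have "(\<lambda>t. q (\<gamma> t)) holomorphic_on ball 0 s"
        proof (rule no_isolated_singularity[where K = "{0}"])
          show "continuous_on (ball 0 s) (\<lambda>t. q (\<gamma> t))"
            unfolding \<gamma>_def
            by (rule continuous_on_compose2[OF contq continuous_on_line])
              (use order_trans[OF s(2) r(2)] in \<open>auto simp: \<gamma>_def\<close>)
          show "(\<lambda>t. q (\<gamma> t)) holomorphic_on ball 0 s - {0}"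
            unfolding \<gamma>_def
          proof (rule holo_on_holomorphic_line[OF off])
            fix t :: complex assume t: "t \<in> ball 0 s - {0}"
            then have "\<gamma> t \<in> S" using s(2) r(2) by blast
            with s(3)[OF t] show "x + t *s axis a 1 \<in> {x \<in> S. f x \<noteq> 0}" by (simp add: \<gamma>_def)
          qed
        qed auto
        then show ?thesis
          using s(1) unfolding \<gamma>_def
          by (intro holomorphic_on_imp_differentiable_at[of _ "ball 0 s"]) auto
      qed
    qed
  qed
qed

section \<open>The lifting criterion\<close>

theorem theorem6p3:
  fixes f :: "complex^'p \<Rightarrow> complex" and n :: nat and U0 :: "(complex^'p) set"
  assumes "n \<ge> 2" and "open U0" and "0 \<in> U0" and "holo_on f U0"
  shows "(\<exists>U F. open U \<and> 0 \<in> U \<and> holo_on F U \<and> (\<forall>x\<in>U. F x ^ n = f x))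
    \<longleftrightarrow>
    ((\<exists>U. open U \<and> 0 \<in> U \<and> (\<forall>x\<in>U. f x = 0)) \<or>
     (\<exists>(A::'p list) U g1 gn. open U \<and> 0 \<in> U \<and> U \<subseteq> U0 \<and>
        holo_on g1 U \<and> holo_on gn U \<and>
        (\<forall>x\<in>U. f x \<noteq> 0 \<longrightarrow>
           (\<forall>V F. open V \<and> x \<in> V \<and> V \<subseteq> U \<and> holo_on F V \<and> (\<forall>y\<in>V. F y ^ n = f y) \<longrightarrow>
              g1 x = F x ^ (n - 1) * cpartials A F x \<and> gn x = (cpartials A F x) ^ n)) \<and>
        gn 0 \<noteq> 0))"
    (is "?lift \<longleftrightarrow> ?zero \<or> ?ext")
proof
  assume ?lift
  then obtain U1 F where U1: "open U1" "0 \<in> U1" and F1: "holo_on F U1" "\<And>x. x \<in> U1 \<Longrightarrow> F x ^ n = f x"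
    by blast
  then obtain R where R: "R > 0" "ball 0 R \<subseteq> U0 \<inter> U1"
    using assms(2,3) open_contains_ball by (metis IntI open_Int)
  \<comment> \<open>A ball, so that \<open>holo_on_ball_eq_0\<close> applies.\<close>
  define U where "U = (ball 0 R :: (complex^'p) set)"
  have U: "open U" "0 \<in> U" "U \<subseteq> U0" and F: "holo_on F U" and root: "\<And>x. x \<in> U \<Longrightarrow> F x ^ n = f x"
    using R F1 holo_on_subset by (auto simp: U_def)
  show "?zero \<or> ?ext"
  proof (cases "\<forall>A. cpartials A F 0 = 0")
    case True
    then have "F x = 0" if "x \<in> U" for x
      using holo_on_ball_eq_0 F that unfolding U_def by blast
    then have "f x = 0" if "x \<in> U" for x
      using root[OF that] that assms(1) by (simp add: power_0_left)
    then show ?thesis using U by blast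
  next
    case False
    then obtain A where A: "cpartials A F 0 \<noteq> 0" by blast
    define g1 gn where "g1 = (\<lambda>x. F x ^ (n - 1) * cpartials A F x)" and "gn = (\<lambda>x. cpartials A F x ^ n)"
    have hol: "holo_on g1 U" "holo_on gn U"
      unfolding g1_def gn_def using holo_on_mult holo_on_power holo_on_cpartials[OF U(1) F] F by blast+
    have "g1 x = G x ^ (n - 1) * cpartials A G x \<and> gn x = cpartials A G x ^ n"
      if x: "x \<in> U" "f x \<noteq> 0" and V: "open V" "x \<in> V" "V \<subseteq> U" and G: "holo_on G V" "\<And>y. y \<in> V \<Longrightarrow> G y ^ n = f y"
      for x V G
    proof -
      have "F x \<noteq> 0" "n > 0" using root[OF x(1)] x(2) assms(1) by (auto simp: power_0_left)
      moreover have "G y ^ n = F y ^ n" if "y \<in> V" for y using that G root V by auto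
      moreover have "continuous_on V F" "continuous_on V G"
        using holo_on_imp_continuous_on holo_on_subset F G V by blast+
      ultimately obtain c W where c: "c ^ n = 1" and W: "open W" "x \<in> W" "W \<subseteq> V" "\<And>y. y \<in> W \<Longrightarrow> G y = c * F y"
        using nth_roots_locally_proportional[OF V(1,2)] by metis
      have "holo_on F W" using F V W holo_on_subset by blast
      have "cpartials A G x = cpartials A (\<lambda>y. c * F y) x"
        using W by (intro cpartials_cong[of W]) auto
      also have "\<dots> = c * cpartials A F x"
        using W \<open>holo_on F W\<close> by (intro cpartials_cmult[of W]) auto
      finally have "cpartials A G x = c * cpartials A F x" .
      \<comment> \<open>\<open>G\<close> contributes \<open>c ^ (n - 1)\<close> through its power
        and \<open>c\<close> through its derivative, so the two factors cancel in \<open>g1\<close>;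
        in \<open>gn\<close> the factor is \<open>c ^ n = 1\<close>.\<close>
      moreover have "c ^ (n - 1) * c = 1"
        using c \<open>n > 0\<close> by (metis power_minus_mult)
      ultimately show ?thesis
        using W(4)[OF W(2)] c by (simp add: g1_def gn_def power_mult_distrib mult_ac)
    qed
    then have ?ext
      using U hol A by (intro exI[of _ A] exI[of _ U] exI[of _ g1] exI[of _ gn]) (auto simp: gn_def)
    then show ?thesis ..
  qed
next
  assume "?zero \<or> ?ext"
  then show ?lift
  proof
    assume ?zero
    then obtain U where "open U" "0 \<in> U" "\<forall>x\<in>U. f x = 0" by blast
    then show ?lift
      using holo_on_const[of 0 U] assms(1) by (intro exI[of _ U] exI[of _ "\<lambda>_. 0"]) auto
  next
    assume ?ext
    then obtain A :: "'p list" and U g1 gn where U: "open U" "0 \<in> U" "U \<subseteq> U0"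
      and g: "holo_on g1 U" "holo_on gn U" "gn 0 \<noteq> 0"
      and ext: "\<forall>x\<in>U. f x \<noteq> 0 \<longrightarrow>
           (\<forall>V F. open V \<and> x \<in> V \<and> V \<subseteq> U \<and> holo_on F V \<and> (\<forall>y\<in>V. F y ^ n = f y) \<longrightarrow>
              g1 x = F x ^ (n - 1) * cpartials A F x \<and> gn x = (cpartials A F x) ^ n)"
      by (elim exE conjE) (rule that)
    have "n > 0" using assms(1) by simp
    from holo_on_nth_root[OF U(1,2) g(2,3) this] obtain S h where
      S: "open S" "0 \<in> S" "S \<subseteq> U" and h: "holo_on h S" "\<And>x. x \<in> S \<Longrightarrow> h x ^ n = gn x" "\<And>x. x \<in> S \<Longrightarrow> h x \<noteq> 0"
      by metis
    have hol: "holo_on f S" "holo_on g1 S"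
      using S U assms(4) g(1) holo_on_subset by blast+
    \<comment> \<open>The branch \<open>F\<close> normalised by \<open>\<partial>\<^sub>A F = h\<close> satisfies \<open>g1 = F\<^sup>n\<^sup>-\<^sup>1 h\<close>, so it must equal \<open>f h / g1\<close>.\<close>
    define q where "q x = (if f x = 0 then 0 else f x * h x / g1 x)" for x
    \<comment> \<open>A single local branch \<open>F\<close> at \<open>x\<close> is enough. Both
      factors of \<open>g1 x\<close> are nonzero there: \<open>F x\<close> because
      \<open>f x\<close> is, and the partial derivative because its \<open>n\<close>-th power is
      \<open>gn x = h x ^ n\<close>.\<close>
    have key: "g1 x \<noteq> 0 \<and> q x ^ n = f x" if x: "x \<in> S" "f x \<noteq> 0" for x
    proof -
      obtain V F where V: "open V" "x \<in> V" "V \<subseteq> S" and F: "holo_on F V" "\<And>y. y \<in> V \<Longrightarrow> F y ^ n = f y"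
        using holo_on_nth_root[OF S(1) x(1) hol(1) x(2) \<open>n > 0\<close>] by metis
      have "g1 x = F x ^ (n - 1) * cpartials A F x" and gn: "gn x = cpartials A F x ^ n"
        using ext[rule_format, of x V F] x V F S by auto
      moreover have "F x \<noteq> 0" using F(2)[OF V(2)] x(2) \<open>n > 0\<close> by (auto simp: power_0_left)
      moreover have "cpartials A F x \<noteq> 0"
        using gn h(2,3)[OF x(1)] \<open>n > 0\<close> by (metis power_eq_0_iff)
      moreover have "f x = F x ^ (n - 1) * F x"
        using F(2)[OF V(2)] \<open>n > 0\<close> by (metis power_minus_mult)
      ultimately have "g1 x \<noteq> 0" and q: "q x = F x * h x / cpartials A F x"
        using x by (auto simp: q_def)
      \<comment> \<open>Both \<open>h x\<close> and \<open>cpartials A F x\<close> are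
        \<open>n\<close>-th roots of \<open>gn x\<close>, so \<open>q x\<close> is
        \<open>F x\<close> times a root of unity.\<close>
      have "q x ^ n = F x ^ n * (h x ^ n / gn x)"
        by (simp add: q gn power_mult_distrib power_divide)
      also have "\<dots> = f x" using F(2)[OF V(2)] h(3)[OF x(1)] by (simp flip: h(2)[OF x(1)])
      finally show ?thesis using \<open>g1 x \<noteq> 0\<close> by blast
    qed
    have op: "open {x \<in> S. f x \<noteq> 0}"
    proof -
      have "{x \<in> S. f x \<noteq> 0} = S \<inter> f -` (- {0})" by auto
      then show ?thesis
        using S(1) holo_on_imp_continuous_on[OF hol(1)] by (auto intro: continuous_open_preimage)
    qed
    have "holo_on (\<lambda>x. f x * h x / g1 x) {x \<in> S. f x \<noteq> 0}"
      using key hol h(1) by (intro holo_on_divide holo_on_mult) (auto intro: holo_on_subset)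
    then have "holo_on q {x \<in> S. f x \<noteq> 0}"
      using op by (rule holo_on_cong) (simp add: q_def)
    moreover have root: "q x ^ n = f x" if "x \<in> S" for x
      using key[of x] that \<open>n > 0\<close> by (cases "f x = 0") (auto simp: q_def)
    ultimately have "holo_on q S"
      using holo_on_nth_root_off_zeros[OF S(1) hol(1) \<open>n > 0\<close>] by blast
    with S root show ?lift by blast
  qed
qed

end
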